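(* Let $R$ be a commutative ring with $1$ such that $\frac12\in R$, let $\mathcal{X}_R=\mathrm{Hom}(R,\mathbb{R})$ be nonempty, and assume the map $R\to C(\mathcal{X}_R)$, $a\mapsto\hat a$, is injective. Let $K\subseteq\mathcal{X}_R$ and let $\Phi:R\to C(K)$ be the homomorphism $\Phi(a)=\hat a|_K$. The following are equivalent: (1) $K$ is Zariski dense in $\mathcal{X}_R$; (2) $\ker\Phi=\{0\}$; (3) $\mathcal{T}_K$ is a Hausdorff topology on $R$.
   Context: $\mathcal{X}_R=\mathrm{Hom}(R,\mathbb{R})$ is the set of unitary ring homomorphisms $\alpha:R\to\mathbb{R}$, with the subspace topology inherited from the product topology on $\mathbb{R}^R$. For $a\in R$, $\hat a:\mathcal{X}_R\to\mathbb{R}$ is $\hat a(\alpha)=\alpha(a)$. $C(K)$ is the algebra of continuous real valued functions on $K$. For $S\subseteq R$, $\mathcal{Z}(S):=\{\alpha\in\mathcal{X}_R:\alpha(S)=\{0\}\}$; the Zariski topology on $\mathcal{X}_R$ has the sets $\mathcal{X}_R\setminus\mathcal{Z}(S)$, $S\subseteq R$, as a subbasis, and $K$ is Zariski dense if it is dense in $\mathcal{X}_R$ for this topology. $\mathcal{T}_K$ is the topology on $R$ generated by the ring-seminorms $\rho_\alpha(a)=|\alpha(a)|$, $\alpha\in K$: a neighborhood basis at $a$ is given by the sets $\{b\in R:|\alpha_i(a-b)|<\epsilon,\ i=1,\dots,m\}$ with $\epsilon>0$ and $\alpha_1,\dots,\alpha_m\in K$. *)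

theory Defs
  imports "HOL-Analysis.Analysis"
begin

text \<open>
  The ring \<open>R\<close> is a type of class \<^class>\<open>comm_ring_1\<close>. A ring with a unitary homomorphism to the
  reals is nonzero, so the class axiom \<open>0 \<noteq> 1\<close> loses nothing.
\<close>

definition real_homs :: "('a::comm_ring_1 \<Rightarrow> real) set" where
  "real_homs = {\<alpha>. \<alpha> 1 = 1 \<and> (\<forall>a b. \<alpha> (a + b) = \<alpha> a + \<alpha> b) \<and> (\<forall>a b. \<alpha> (a * b) = \<alpha> a * \<alpha> b)}"

definition hat :: "'a \<Rightarrow> ('a \<Rightarrow> real) \<Rightarrow> real" where
  "hat a \<alpha> = \<alpha> a"

text \<open>
  The type class topology on \<open>'a \<Rightarrow> real\<close> is the product topology, so \<^const>\<open>continuous_on\<close> below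
  refers to the subspace topology inherited from it. Functions on \<open>K\<close> are \<^const>\<open>extensional\<close>, so
  that two of them are equal iff they agree on \<open>K\<close>.
\<close>

definition cont_funs :: "('a \<Rightarrow> real) set \<Rightarrow> (('a \<Rightarrow> real) \<Rightarrow> real) set" where
  "cont_funs K = {f \<in> extensional K. continuous_on K f}"

definition Phi :: "('a \<Rightarrow> real) set \<Rightarrow> 'a \<Rightarrow> ('a \<Rightarrow> real) \<Rightarrow> real" where
  "Phi K a = restrict (hat a) K"

definition ker_Phi :: "('a \<Rightarrow> real) set \<Rightarrow> 'a set" where
  "ker_Phi K = {a. Phi K a = (\<lambda>\<alpha>\<in>K. 0)}"

lemma Phi_in_cont_funs: "Phi K a \<in> cont_funs K"
proof -
  have "continuous_on K (\<lambda>\<alpha>. \<alpha> a)"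
    by (rule continuous_on_product_then_coordinatewise[OF continuous_on_id])
  then show ?thesis
    by (simp add: cont_funs_def Phi_def hat_def cong: continuous_on_cong)
qed

lemma Phi_hom:
  assumes "K \<subseteq> real_homs"
  shows "Phi K 1 = (\<lambda>\<alpha>\<in>K. 1)"
    and "Phi K (a + b) = (\<lambda>\<alpha>\<in>K. Phi K a \<alpha> + Phi K b \<alpha>)"
    and "Phi K (a * b) = (\<lambda>\<alpha>\<in>K. Phi K a \<alpha> * Phi K b \<alpha>)"
  using assms by (auto simp: Phi_def hat_def real_homs_def fun_eq_iff)

definition zero_set :: "'a::comm_ring_1 set \<Rightarrow> ('a \<Rightarrow> real) set" where
  "zero_set S = {\<alpha> \<in> real_homs. \<forall>a\<in>S. \<alpha> a = 0}"

definition zariski :: "('a::comm_ring_1 \<Rightarrow> real) topology" where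
  "zariski = topology_generated_by (range (\<lambda>S. real_homs - zero_set S))"

lemma topspace_zariski: "topspace zariski = real_homs"
proof -
  have "real_homs - zero_set {1 :: 'a} = real_homs"
    by (auto simp: zero_set_def real_homs_def)
  then have "real_homs \<subseteq> (\<Union>S :: 'a set. real_homs - zero_set S)"
    by (metis UN_upper UNIV_I)
  then show ?thesis
    unfolding zariski_def topology_generated_by_topspace by (intro equalityI) (simp_all add: UN_subset_iff)
qed

definition zariski_dense :: "('a::comm_ring_1 \<Rightarrow> real) set \<Rightarrow> bool" where
  "zariski_dense K \<longleftrightarrow> zariski closure_of K = real_homs"

definition rho :: "('a \<Rightarrow> real) \<Rightarrow> 'a \<Rightarrow> real" where
  "rho \<alpha> a = \<bar>\<alpha> a\<bar>"

text \<open>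
  The finite set \<open>F\<close> may be empty, so for \<open>K = {}\<close> this is the indiscrete topology on \<open>R\<close>;
  generating the topology by a subbasis of balls would give an empty underlying space instead.
\<close>

definition seminorm_topology :: "('a::comm_ring_1 \<Rightarrow> real) set \<Rightarrow> 'a topology" where
  "seminorm_topology K = topology (\<lambda>U. \<forall>a\<in>U. \<exists>F \<epsilon>. finite F \<and> F \<subseteq> K \<and> \<epsilon> > 0 \<and>
     {b. \<forall>\<alpha>\<in>F. rho \<alpha> (a - b) < \<epsilon>} \<subseteq> U)"

lemma openin_seminorm_topology:
  "openin (seminorm_topology K) U \<longleftrightarrow> (\<forall>a\<in>U. \<exists>F \<epsilon>. finite F \<and> F \<subseteq> K \<and> \<epsilon> > 0 \<and>
     {b. \<forall>\<alpha>\<in>F. rho \<alpha> (a - b) < \<epsilon>} \<subseteq> U)"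
proof -
  define N where "N = (\<lambda>a F \<epsilon>. {b::'a. \<forall>\<alpha>\<in>F. rho \<alpha> (a - b) < (\<epsilon>::real)})"
  have "istopology (\<lambda>U. \<forall>a\<in>U. \<exists>F \<epsilon>. finite F \<and> F \<subseteq> K \<and> \<epsilon> > 0 \<and> N a F \<epsilon> \<subseteq> U)"
    unfolding istopology_def
  proof (intro conjI allI impI ballI)
    fix S T a
    assume S: "\<forall>a\<in>S. \<exists>F \<epsilon>. finite F \<and> F \<subseteq> K \<and> \<epsilon> > 0 \<and> N a F \<epsilon> \<subseteq> S"
      and T: "\<forall>a\<in>T. \<exists>F \<epsilon>. finite F \<and> F \<subseteq> K \<and> \<epsilon> > 0 \<and> N a F \<epsilon> \<subseteq> T"
      and a: "a \<in> S \<inter> T"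
    from S[rule_format, OF IntD1[OF a]] obtain F d
      where F: "finite F" "F \<subseteq> K" "d > 0" "N a F d \<subseteq> S"
      by (elim exE conjE)
    from T[rule_format, OF IntD2[OF a]] obtain G e
      where G: "finite G" "G \<subseteq> K" "e > 0" "N a G e \<subseteq> T"
      by (elim exE conjE)
    have "N a (F \<union> G) (min d e) \<subseteq> N a F d \<inter> N a G e"
      by (auto simp: N_def)
    then have "N a (F \<union> G) (min d e) \<subseteq> S \<inter> T"
      using F(4) G(4) by blast
    moreover have "finite (F \<union> G)" "F \<union> G \<subseteq> K" "min d e > 0"
      using F G by auto
    ultimately show "\<exists>F \<epsilon>. finite F \<and> F \<subseteq> K \<and> \<epsilon> > 0 \<and> N a F \<epsilon> \<subseteq> S \<inter> T"
      by (intro exI conjI)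
  next
    fix \<U> a
    assume \<U>: "\<forall>U\<in>\<U>. \<forall>a\<in>U. \<exists>F \<epsilon>. finite F \<and> F \<subseteq> K \<and> \<epsilon> > 0 \<and> N a F \<epsilon> \<subseteq> U"
      and "a \<in> \<Union>\<U>"
    then obtain U where "U \<in> \<U>" "a \<in> U" by blast
    from \<U>[rule_format, OF this] obtain F e
      where F: "finite F" "F \<subseteq> K" "e > 0" "N a F e \<subseteq> U"
      by (elim exE conjE)
    from F(4) \<open>U \<in> \<U>\<close> have "N a F e \<subseteq> \<Union>\<U>"
      by (rule order_trans[OF _ Union_upper])
    with F(1-3) show "\<exists>F \<epsilon>. finite F \<and> F \<subseteq> K \<and> \<epsilon> > 0 \<and> N a F \<epsilon> \<subseteq> \<Union>\<U>"
      by (intro exI conjI)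
  qed
  then show ?thesis
    unfolding seminorm_topology_def N_def by (rule topology_inverse'[THEN fun_cong])
qed

lemma topspace_seminorm_topology: "topspace (seminorm_topology K) = UNIV"
proof -
  have "openin (seminorm_topology K) UNIV"
    unfolding openin_seminorm_topology
  proof
    fix a :: 'a
    have "finite {} \<and> {} \<subseteq> K \<and> (1::real) > 0 \<and> {b. \<forall>\<alpha>\<in>{}. rho \<alpha> (a - b) < 1} \<subseteq> UNIV"
      by simp
    then show "\<exists>F \<epsilon>. finite F \<and> F \<subseteq> K \<and> \<epsilon> > 0 \<and>
        {b. \<forall>\<alpha>\<in>F. rho \<alpha> (a - b) < \<epsilon>} \<subseteq> UNIV"
      by (intro exI)
  qed
  from openin_subset[OF this] show ?thesis
    by (rule top.extremum_uniqueI)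
qed

end

theory Submission imports Defs begin

text \<open>
  Since real homomorphisms are multiplicative, the sets \<open>{\<alpha>. \<alpha> a \<noteq> 0}\<close> are closed under
  finite intersection and hence form a basis, not just a subbasis, of the Zariski topology; they are
  nonempty for \<open>a \<noteq> 0\<close> by injectivity of \<open>a \<mapsto> hat a\<close>. So density of \<open>K\<close> and the
  Hausdorff property both say that every nonzero \<open>a\<close> is detected by some \<open>\<alpha> \<in> K\<close>.
\<close>

lemma real_homs_simps:
  assumes "\<alpha> \<in> real_homs"
  shows "\<alpha> 1 = 1" and "\<alpha> (a + b) = \<alpha> a + \<alpha> b" and "\<alpha> (a * b) = \<alpha> a * \<alpha> b"
    and "\<alpha> 0 = 0" and "\<alpha> (a - b) = \<alpha> a - \<alpha> b"
proof -
  show add: "\<alpha> (a + b) = \<alpha> a + \<alpha> b" for a b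
    using assms by (simp add: real_homs_def)
  show "\<alpha> 1 = 1" "\<alpha> (a * b) = \<alpha> a * \<alpha> b"
    using assms by (simp_all add: real_homs_def)
  show "\<alpha> 0 = 0" using add[of 0 0] by simp
  show "\<alpha> (a - b) = \<alpha> a - \<alpha> b" using add[of "a - b" b] by simp
qed

lemma ker_Phi_eq: "ker_Phi K = {a. \<forall>\<alpha>\<in>K. \<alpha> a = 0}"
  by (auto simp: ker_Phi_def Phi_def hat_def fun_eq_iff restrict_def)

text \<open>Members of \<open>K\<close> send 0 to 0, so the kernel always contains 0 and is trivial
  exactly when it has no nonzero element. The right-hand side is the common form to which all three
  conditions are reduced.\<close>

lemma ker_Phi_trivial_iff:
  assumes "K \<subseteq> real_homs"
  shows "ker_Phi K = {0} \<longleftrightarrow> (\<forall>a. a \<noteq> 0 \<longrightarrow> (\<exists>\<alpha>\<in>K. \<alpha> a \<noteq> 0))"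
proof -
  have "0 \<in> ker_Phi K"
    using assms real_homs_simps(4) unfolding ker_Phi_eq by blast
  then have "ker_Phi K = {0} \<longleftrightarrow> (\<forall>a. a \<noteq> 0 \<longrightarrow> a \<notin> ker_Phi K)" by blast
  then show ?thesis by (simp add: ker_Phi_eq)
qed

lemma openin_zariski_nonvanishing: "openin zariski {\<alpha> \<in> real_homs. \<alpha> a \<noteq> 0}"
proof -
  have "{\<alpha> \<in> real_homs. \<alpha> a \<noteq> 0} = real_homs - zero_set {a}"
    by (auto simp: zero_set_def)
  then show ?thesis
    unfolding zariski_def by (simp add: topology_generated_by_Basis)
qed

text \<open>Induction on how \<open>U\<close> is generated from the subbasis. The witness for an
  intersection is the product of the two witnesses: real numbers have no zero divisors, so a
  homomorphism is nonzero on \<open>a * b\<close> iff it is nonzero on both \<open>a\<close> and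
  \<open>b\<close>.\<close>

lemma openin_zariski_basis:
  assumes "openin zariski U" and "\<beta> \<in> U"
  obtains a where "\<beta> a \<noteq> 0" and "{\<alpha> \<in> real_homs. \<alpha> a \<noteq> 0} \<subseteq> U"
proof -
  have "generate_topology_on (range (\<lambda>S. real_homs - zero_set S)) U"
    using assms(1) by (simp add: zariski_def openin_topology_generated_by_iff)
  then have "\<forall>\<beta>\<in>U. \<exists>a. \<beta> a \<noteq> 0 \<and> {\<alpha> \<in> real_homs. \<alpha> a \<noteq> 0} \<subseteq> U"
  proof induction
    case Empty
    then show ?case by simp
  next
    case (Int U V)
    show ?case
    proof
      fix \<beta> assume \<beta>: "\<beta> \<in> U \<inter> V"
      from Int.IH(1)[rule_format, OF IntD1[OF \<beta>]]
      obtain a where a: "\<beta> a \<noteq> 0" "{\<alpha> \<in> real_homs. \<alpha> a \<noteq> 0} \<subseteq> U"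
        by (elim exE conjE)
      from Int.IH(2)[rule_format, OF IntD2[OF \<beta>]]
      obtain b where b: "\<beta> b \<noteq> 0" "{\<alpha> \<in> real_homs. \<alpha> b \<noteq> 0} \<subseteq> V"
        by (elim exE conjE)
      \<comment> \<open>Multiplicativity at \<beta> requires \<beta> to be a homomorphism. This
        follows from openness of \<open>U\<close>, as open sets lie in the underlying space
        \<open>real_homs\<close>.\<close>
      have "openin zariski U"
        using Int.hyps(1) by (simp add: zariski_def openin_topology_generated_by_iff)
      then have "\<beta> \<in> real_homs"
        using \<beta> openin_subset topspace_zariski by blast
      then have "\<beta> (a * b) \<noteq> 0"
        using a(1) b(1) by (simp add: real_homs_simps(3))
      moreover have "\<alpha> a \<noteq> 0 \<and> \<alpha> b \<noteq> 0" if "\<alpha> \<in> real_homs" "\<alpha> (a * b) \<noteq> 0" for \<alpha>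
        using that real_homs_simps(3)[OF that(1)] by simp
      then have "{\<alpha> \<in> real_homs. \<alpha> (a * b) \<noteq> 0} \<subseteq> U \<inter> V"
        using a(2) b(2) by blast
      ultimately show "\<exists>c. \<beta> c \<noteq> 0 \<and> {\<alpha> \<in> real_homs. \<alpha> c \<noteq> 0} \<subseteq> U \<inter> V"
        by (intro exI conjI)
    qed
  next
    case (UN \<U>)
    show ?case
    proof
      fix \<beta> assume "\<beta> \<in> \<Union>\<U>"
      then obtain U where U: "U \<in> \<U>" "\<beta> \<in> U" by blast
      from UN.IH[rule_format, OF this]
      obtain a where a: "\<beta> a \<noteq> 0" "{\<alpha> \<in> real_homs. \<alpha> a \<noteq> 0} \<subseteq> U"
        by (elim exE conjE)
      from a(2) U(1) have "{\<alpha> \<in> real_homs. \<alpha> a \<noteq> 0} \<subseteq> \<Union>\<U>"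
        by (rule order_trans[OF _ Union_upper])
      with a(1) show "\<exists>a. \<beta> a \<noteq> 0 \<and> {\<alpha> \<in> real_homs. \<alpha> a \<noteq> 0} \<subseteq> \<Union>\<U>"
        by (intro exI conjI)
    qed
  next
    case (Basis U)
    then obtain S where U: "U = real_homs - zero_set S" by blast
    show ?case
    proof
      \<comment> \<open>Being nonzero at a single element of \<open>S\<close> already keeps a
        homomorphism out of \<open>zero_set S\<close>, so any element of \<open>S\<close> on which
        \<beta> is nonzero serves as witness.\<close>
      fix \<beta> assume "\<beta> \<in> U"
      then obtain a where "a \<in> S" "\<beta> a \<noteq> 0"
        by (auto simp: U zero_set_def)
      moreover from \<open>a \<in> S\<close> have "{\<alpha> \<in> real_homs. \<alpha> a \<noteq> 0} \<subseteq> U"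
        by (auto simp: U zero_set_def)
      ultimately show "\<exists>a. \<beta> a \<noteq> 0 \<and> {\<alpha> \<in> real_homs. \<alpha> a \<noteq> 0} \<subseteq> U"
        by (intro exI conjI)
    qed
  qed
  from this[rule_format, OF assms(2)] show thesis
    by (elim exE conjE) (rule that)
qed

text \<open>Forward, the set of homomorphisms nonzero at \<open>a\<close> is open, and nonempty by
  injectivity, so a dense \<open>K\<close> meets it. Backward, it suffices to meet every basic
  neighborhood of a given \<beta>.\<close>

lemma zariski_dense_iff:
  assumes "inj (Phi (real_homs :: ('a::comm_ring_1 \<Rightarrow> real) set))"
    and "K \<subseteq> (real_homs :: ('a \<Rightarrow> real) set)"
  shows "zariski_dense K \<longleftrightarrow> (\<forall>a. a \<noteq> 0 \<longrightarrow> (\<exists>\<alpha>\<in>K. \<alpha> a \<noteq> 0))"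
proof
  assume dense: "zariski_dense K"
  show "\<forall>a. a \<noteq> 0 \<longrightarrow> (\<exists>\<alpha>\<in>K. \<alpha> a \<noteq> 0)"
  proof (intro allI impI)
    fix a :: 'a assume "a \<noteq> 0"
    then have "Phi real_homs a \<noteq> Phi real_homs 0"
      using assms(1) by (auto dest: injD)
    \<comment> \<open>The two restricted functions must differ at a point of
      \<open>real_homs\<close>, and there the image of 0 is 0.\<close>
    then obtain \<beta> where "\<beta> \<in> real_homs" "\<beta> a \<noteq> 0"
      using real_homs_simps(4) by (metis (no_types, lifting) Phi_def hat_def restrict_ext)
    define D where "D = {\<alpha> \<in> real_homs. \<alpha> a \<noteq> 0}"
    have "openin zariski D" "\<beta> \<in> D"
      using openin_zariski_nonvanishing \<open>\<beta> \<in> real_homs\<close> \<open>\<beta> a \<noteq> 0\<close> by (simp_all add: D_def)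
    moreover have "\<beta> \<in> zariski closure_of K"
      using dense \<open>\<beta> \<in> real_homs\<close> by (simp add: zariski_dense_def)
    ultimately obtain \<alpha> where "\<alpha> \<in> K" "\<alpha> \<in> D"
      unfolding in_closure_of by metis
    then show "\<exists>\<alpha>\<in>K. \<alpha> a \<noteq> 0" by (auto simp: D_def)
  qed
next
  assume sep: "\<forall>a. a \<noteq> 0 \<longrightarrow> (\<exists>\<alpha>\<in>K. \<alpha> a \<noteq> 0)"
  have "\<beta> \<in> zariski closure_of K" if \<beta>: "\<beta> \<in> real_homs" for \<beta>
    unfolding in_closure_of topspace_zariski
  proof (intro conjI allI impI \<beta>)
    fix U assume "\<beta> \<in> U \<and> openin zariski U"
    then obtain a where a: "\<beta> a \<noteq> 0" "{\<alpha> \<in> real_homs. \<alpha> a \<noteq> 0} \<subseteq> U"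
      by (elim conjE openin_zariski_basis)
    \<comment> \<open>A homomorphism kills 0, so \<beta> being nonzero at \<open>a\<close> rules out
      \<open>a = 0\<close>, and the separation hypothesis applies.\<close>
    then have "a \<noteq> 0" using real_homs_simps(4)[OF \<beta>] by auto
    then obtain \<alpha> where "\<alpha> \<in> K" "\<alpha> a \<noteq> 0" using sep by metis
    then show "\<exists>\<alpha>. \<alpha> \<in> K \<and> \<alpha> \<in> U" using a(2) assms(2) by auto
  qed
  then show "zariski_dense K"
    unfolding zariski_dense_def topspace_zariski[symmetric]
    by (intro equalityI closure_of_subset_topspace subsetI)
qed

lemma openin_seminorm_topology_ball:
  assumes "\<alpha> \<in> K" and "\<alpha> \<in> real_homs"
  shows "openin (seminorm_topology K) {b. rho \<alpha> (a - b) < r}"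
  unfolding openin_seminorm_topology
proof
  fix b assume b: "b \<in> {b. rho \<alpha> (a - b) < r}"
  \<comment> \<open>The radius left over at \<open>b\<close> works by the triangle inequality for
    \<open>rho \<alpha>\<close>.\<close>
  have "finite {\<alpha>} \<and> {\<alpha>} \<subseteq> K \<and> r - rho \<alpha> (a - b) > 0 \<and>
      {c. \<forall>\<gamma>\<in>{\<alpha>}. rho \<gamma> (b - c) < r - rho \<alpha> (a - b)} \<subseteq> {b. rho \<alpha> (a - b) < r}"
    using assms(1) b by (auto simp: rho_def real_homs_simps(5)[OF assms(2)])
  then show "\<exists>F \<epsilon>. finite F \<and> F \<subseteq> K \<and> \<epsilon> > 0 \<and>
      {c. \<forall>\<gamma>\<in>F. rho \<gamma> (b - c) < \<epsilon>} \<subseteq> {b. rho \<alpha> (a - b) < r}"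
    by (intro exI)
qed

text \<open>An element on which all of \<open>K\<close> vanishes cannot be separated from 0.
  Conversely, if \<alpha> in \<open>K\<close> is nonzero at \<open>a - b\<close>, then small
  \<open>rho \<alpha>\<close>-balls around \<open>a\<close> and \<open>b\<close> are
  disjoint.\<close>

lemma Hausdorff_seminorm_topology_iff:
  assumes "K \<subseteq> real_homs"
  shows "Hausdorff_space (seminorm_topology K) \<longleftrightarrow> (\<forall>a. a \<noteq> 0 \<longrightarrow> (\<exists>\<alpha>\<in>K. \<alpha> a \<noteq> 0))"
proof
  assume H: "Hausdorff_space (seminorm_topology K)"
  show "\<forall>a. a \<noteq> 0 \<longrightarrow> (\<exists>\<alpha>\<in>K. \<alpha> a \<noteq> 0)"
  proof (intro allI impI, rule ccontr)
    fix a :: 'a assume "a \<noteq> 0" and vanish: "\<not> (\<exists>\<alpha>\<in>K. \<alpha> a \<noteq> 0)"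
    then obtain U V where U: "openin (seminorm_topology K) U" "a \<in> U"
      and V: "0 \<in> V" "disjnt U V"
      using H unfolding Hausdorff_space_def topspace_seminorm_topology by (metis UNIV_I)
    obtain F \<epsilon> where F: "F \<subseteq> K" "\<epsilon> > 0" "{b. \<forall>\<alpha>\<in>F. rho \<alpha> (a - b) < \<epsilon>} \<subseteq> U"
      using U unfolding openin_seminorm_topology by meson
    \<comment> \<open>The seminorms from \<open>F\<close> all vanish at \<open>a - 0 = a\<close>, so
      0 lies in every basic neighborhood of \<open>a\<close>, whatever the radius.\<close>
    have "0 \<in> {b. \<forall>\<alpha>\<in>F. rho \<alpha> (a - b) < \<epsilon>}"
      using F(1,2) vanish by (auto simp: rho_def dest!: subsetD)
    with F(3) have "0 \<in> U" by (rule subsetD)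
    then show False using V by (auto simp: disjnt_iff)
  qed
next
  assume sep: "\<forall>a. a \<noteq> 0 \<longrightarrow> (\<exists>\<alpha>\<in>K. \<alpha> a \<noteq> 0)"
  show "Hausdorff_space (seminorm_topology K)"
    unfolding Hausdorff_space_def topspace_seminorm_topology
  proof (intro allI impI)
    fix a b :: 'a assume "a \<in> UNIV \<and> b \<in> UNIV \<and> a \<noteq> b"
    then have "a - b \<noteq> 0" by simp
    then obtain \<alpha> where \<alpha>: "\<alpha> \<in> K" "\<alpha> (a - b) \<noteq> 0" using sep by metis
    with assms have hom: "\<alpha> \<in> real_homs" by blast
    \<comment> \<open>Half the distance between \<open>\<alpha> a\<close> and
      \<open>\<alpha> b\<close>: a common point of the two open balls would put these values at
      distance less than \<open>2 * r\<close>.\<close>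
    define r where "r = \<bar>\<alpha> (a - b)\<bar> / 2"
    have "r > 0" using \<alpha>(2) by (simp add: r_def)
    then have "a \<in> {c. rho \<alpha> (a - c) < r}" "b \<in> {c. rho \<alpha> (b - c) < r}"
      by (simp_all add: rho_def real_homs_simps(4)[OF hom])
    moreover have "disjnt {c. rho \<alpha> (a - c) < r} {c. rho \<alpha> (b - c) < r}"
      by (auto simp: disjnt_iff rho_def r_def real_homs_simps(5)[OF hom] abs_if field_simps split: if_splits)
    ultimately show "\<exists>U V. openin (seminorm_topology K) U \<and> openin (seminorm_topology K) V \<and>
        a \<in> U \<and> b \<in> V \<and> disjnt U V"
      using openin_seminorm_topology_ball[OF \<alpha>(1) hom] by blast
  qed
qed

theorem theorem3p3:
  fixes K :: "('a::comm_ring_1 \<Rightarrow> real) set"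
  assumes half: "\<exists>h::'a. 2 * h = 1"
    and nonempty: "(real_homs :: ('a \<Rightarrow> real) set) \<noteq> {}"
    and inj_hat: "inj (Phi (real_homs :: ('a \<Rightarrow> real) set))"
    and K: "K \<subseteq> real_homs"
  shows "(zariski_dense K \<longleftrightarrow> ker_Phi K = {0}) \<and>
         (ker_Phi K = {0} \<longleftrightarrow> Hausdorff_space (seminorm_topology K))"
  unfolding zariski_dense_iff[OF inj_hat K] ker_Phi_trivial_iff[OF K]
    Hausdorff_seminorm_topology_iff[OF K] by simp

end
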